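(* There exists a constant $c>0$ such that for all integers $n\ge 2$, \[c\,\frac{n}{\log_2 n}\le c_D(T_n)\le 2n,\] where $T_n$ is the binary tree of depth $n$ and $c_D(T_n)$ is the distortion of embeddings of $T_n$ into the sequence of diamond graphs $\{D_m\}_{m=1}^\infty$.
   Context: All graphs are identified with their vertex sets endowed with the shortest path distance (the distance between two vertices is the number of edges in a shortest path between them). Binary tree: the binary tree $T_n$ of depth $n$ is the finite graph whose vertices are the finite (possibly empty) sequences of $0$'s and $1$'s of length at most $n$; two vertices are adjacent if the sequence representing one of them is obtained from the sequence representing the other by adding one term on the right. Diamond graphs: $D_0$ consists of two vertices joined by an edge. For $m\ge 1$, $D_m$ is obtained from $D_{m-1}$ by replacing each edge $uv\in E(D_{m-1})$ by a quadrilateral $u,a,v,b$ with edges $ua$, $av$, $vb$, $bu$ (with $a,b$ new vertices, distinct for distinct edges). Distortion: let $M$ be a finite metric space and $\{R_m\}_{m=1}^\infty$ a sequence of metric spaces. The distortion $c_R(M)$ of embeddings of $M$ into $\{R_m\}_{m=1}^\infty$ is the infimum of those $C\ge 1$ for which there exist $m\in\mathbb{N}$, a map $f:M\to R_m$, and a number $r>0$ such that \[\forall u,v\in M\quad r\,d_M(u,v)\le d_{R_m}(f(u),f(v))\le rC\,d_M(u,v).\] $c_D(T_n)$ denotes this quantity for $M=T_n$ and $R_m=D_m$. *)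

theory Defs
  imports "HOL-Analysis.Analysis" "Graph_Theory.Digraph_Component"
begin

section \<open>The shortest path metric of a graph\<close>

text \<open>
  An undirected simple graph is a \<open>pair_graph\<close>: each edge \<open>uv\<close> is represented by the two
  arcs \<open>(u, v)\<close> and \<open>(v, u)\<close>. A path (\<open>apath\<close>) is the list of its arcs, so its length
  is its number of edges.
\<close>

definition graph_dist :: "'a pair_pre_digraph \<Rightarrow> 'a \<Rightarrow> 'a \<Rightarrow> nat" where
  "graph_dist G u v = (LEAST k. \<exists>p. pre_digraph.apath (with_proj G) u p v \<and> length p = k)"

text \<open>
  The constructor \<open>metric\<close> is only specified on metric spaces; for connected graphs
  see \<open>mspace_graph_metric\<close> and \<open>mdist_graph_metric\<close> below.
\<close>

definition graph_metric :: "'a pair_pre_digraph \<Rightarrow> 'a metric" where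
  "graph_metric G = metric (pverts G, \<lambda>u v. real (graph_dist G u v))"

context pair_sym_digraph
begin

lemma apath_of_awalk:
  assumes "awalk u p v"
  obtains q where "apath u q v" "length q \<le> length p"
proof
  let ?q = "awalk_to_apath p"
  show ap: "apath u ?q v" using assms by (rule apath_awalk_to_apath)
  then have "distinct ?q"
    by (auto simp: apath_def intro: distinct_verts_imp_distinct)
  then have "length ?q = card (set ?q)" by (simp add: distinct_card)
  also have "\<dots> \<le> card (set p)"
    using awalk_to_apath_subset[OF assms] by (intro card_mono) auto
  also have "\<dots> \<le> length p" by (rule card_length)
  finally show "length ?q \<le> length p" .
qed

lemma graph_dist_le:
  assumes "awalk u p v"
  shows "graph_dist G u v \<le> length p"
proof -
  from assms obtain q where q: "apath u q v" "length q \<le> length p"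
    by (rule apath_of_awalk)
  have "graph_dist G u v \<le> length q"
    unfolding graph_dist_def using q(1) by (intro Least_le) auto
  with q(2) show ?thesis by simp
qed

lemma graph_dist_apath:
  assumes "u \<rightarrow>\<^sup>*\<^bsub>G\<^esub> v"
  obtains p where "apath u p v" "length p = graph_dist G u v"
proof -
  from assms have "\<exists>k p. apath u p v \<and> length p = k"
    by (auto simp: reachable_apath)
  then have "\<exists>p. apath u p v \<and> length p = graph_dist G u v"
    unfolding graph_dist_def by (rule LeastI_ex)
  with that show ?thesis by blast
qed

lemma awalk_reverse:
  assumes "awalk u p v"
  shows "\<exists>q. awalk v q u \<and> length q = length p"
  using assms
proof (induction p arbitrary: u)
  case Nil
  then show ?case by (intro exI[of _ "[]"]) (auto simp: awalk_Nil_iff)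
next
  case (Cons e p)
  then obtain w where e: "e = (u, w)" "(u, w) \<in> parcs G" "awalk w p v"
    by (cases e) (auto simp: awalk_Cons_iff)
  from Cons.IH[OF e(3)] obtain q where q: "awalk v q w" "length q = length p"
    by blast
  have "(w, u) \<in> parcs G"
    using e(2) pair_sym_arcs by (auto simp: symmetric_def sym_def)
  then have "awalk w [(w, u)] u"
    by (auto simp: awalk_Cons_iff awalk_Nil_iff dest: in_arcsD1 in_arcsD2)
  with q(1) have "awalk v (q @ [(w, u)]) u" by (rule awalk_appendI)
  with q(2) show ?case by (intro exI[of _ "q @ [(w, u)]"]) auto
qed

lemma graph_dist_le_sym:
  assumes "u \<rightarrow>\<^sup>*\<^bsub>G\<^esub> v"
  shows "graph_dist G v u \<le> graph_dist G u v"
proof -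
  from assms obtain p where p: "apath u p v" "length p = graph_dist G u v"
    by (rule graph_dist_apath)
  then have "awalk u p v" by (simp add: awalkI_apath)
  with awalk_reverse p(2) graph_dist_le show ?thesis by metis
qed

lemma graph_dist_sym: "graph_dist G u v = graph_dist G v u"
proof (cases "u \<rightarrow>\<^sup>*\<^bsub>G\<^esub> v")
  case True
  have "v \<rightarrow>\<^sup>*\<^bsub>G\<^esub> u" using pair_sym_arcs True by (rule symmetric_reachable)
  from graph_dist_le_sym[OF True] graph_dist_le_sym[OF this] show ?thesis by simp
next
  case False
  then have "\<not> v \<rightarrow>\<^sup>*\<^bsub>G\<^esub> u" using symmetric_reachable[OF pair_sym_arcs, of v u] by blast
  with False show ?thesis by (simp add: graph_dist_def reachable_apath)
qed

lemma Metric_space_graph_dist: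
  assumes "\<And>u v. u \<in> pverts G \<Longrightarrow> v \<in> pverts G \<Longrightarrow> u \<rightarrow>\<^sup>*\<^bsub>G\<^esub> v"
  shows "Metric_space (pverts G) (\<lambda>u v. real (graph_dist G u v))"
proof
  show "0 \<le> real (graph_dist G u v)" for u v by simp
  show "real (graph_dist G u v) = real (graph_dist G v u)" for u v
    by (simp add: graph_dist_sym)
next
  fix u v assume uv: "u \<in> pverts G" "v \<in> pverts G"
  then have "u \<rightarrow>\<^sup>*\<^bsub>G\<^esub> v" by (rule assms)
  then obtain p where p: "apath u p v" "length p = graph_dist G u v"
    by (rule graph_dist_apath)
  have "awalk u [] u" using uv by (simp add: awalk_Nil_iff)
  from graph_dist_le[OF this] have "graph_dist G u u = 0" by simp
  with p show "real (graph_dist G u v) = 0 \<longleftrightarrow> u = v"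
    by (auto simp: apath_Nil_iff)
next
  fix u v w assume uvw: "u \<in> pverts G" "v \<in> pverts G" "w \<in> pverts G"
  obtain p where p: "apath u p v" "length p = graph_dist G u v"
    using graph_dist_apath[OF assms[OF uvw(1,2)]] .
  obtain q where q: "apath v q w" "length q = graph_dist G v w"
    using graph_dist_apath[OF assms[OF uvw(2,3)]] .
  have "awalk u (p @ q) w"
    using p(1) q(1) by (intro awalk_appendI) (auto intro: awalkI_apath)
  from graph_dist_le[OF this] p(2) q(2)
  show "real (graph_dist G u w) \<le> real (graph_dist G u v) + real (graph_dist G v w)"
    by simp
qed

lemma mspace_graph_metric:
  assumes "\<And>u v. u \<in> pverts G \<Longrightarrow> v \<in> pverts G \<Longrightarrow> u \<rightarrow>\<^sup>*\<^bsub>G\<^esub> v"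
  shows "mspace (graph_metric G) = pverts G"
  using Metric_space.mspace_metric[OF Metric_space_graph_dist[OF assms]]
  by (simp add: graph_metric_def)

lemma mdist_graph_metric:
  assumes "\<And>u v. u \<in> pverts G \<Longrightarrow> v \<in> pverts G \<Longrightarrow> u \<rightarrow>\<^sup>*\<^bsub>G\<^esub> v"
  shows "mdist (graph_metric G) u v = real (graph_dist G u v)"
  using Metric_space.mdist_metric[OF Metric_space_graph_dist[OF assms]]
  by (simp add: graph_metric_def)

lemma reachable_if_root:
  assumes root: "\<And>u. u \<in> pverts G \<Longrightarrow> (u, r) \<in> (parcs G)\<^sup>*"
    and u: "u \<in> pverts G" and v: "v \<in> pverts G"
  shows "u \<rightarrow>\<^sup>*\<^bsub>G\<^esub> v"
proof -
  have "u \<rightarrow>\<^sup>*\<^bsub>G\<^esub> r" using reachable_conv'[OF u] root[OF u] by simp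
  also have "v \<rightarrow>\<^sup>*\<^bsub>G\<^esub> r" using reachable_conv'[OF v] root[OF v] by simp
  then have "r \<rightarrow>\<^sup>*\<^bsub>G\<^esub> v" by (rule symmetric_reachable[OF pair_sym_arcs])
  finally show ?thesis .
qed

end


section \<open>Binary trees\<close>

definition binary_tree :: "nat \<Rightarrow> bool list pair_pre_digraph" where
  "binary_tree n =
    \<lparr> pverts = {xs. length xs \<le> n},
      parcs = {(xs, ys). length xs \<le> n \<and> length ys \<le> n \<and>
                         (\<exists>b. ys = xs @ [b] \<or> xs = ys @ [b])} \<rparr>"

lemma pair_graph_binary_tree: "pair_graph (binary_tree n)"
proof -
  have fin: "finite {xs :: bool list. length xs \<le> n}"
    using finite_lists_length_le[of "UNIV :: bool set" n] by simp
  have "finite (parcs (binary_tree n))"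
    by (rule finite_subset[OF _ finite_cartesian_product[OF fin fin]])
       (auto simp: binary_tree_def)
  with fin show ?thesis
    by unfold_locales (auto simp: binary_tree_def symmetric_def sym_def)
qed

lemma binary_tree_connected:
  assumes "u \<in> pverts (binary_tree n)" "v \<in> pverts (binary_tree n)"
  shows "u \<rightarrow>\<^sup>*\<^bsub>binary_tree n\<^esub> v"
proof -
  interpret pair_graph "binary_tree n" by (rule pair_graph_binary_tree)
  have "(xs, []) \<in> (parcs (binary_tree n))\<^sup>*" if "xs \<in> pverts (binary_tree n)" for xs
    using that
  proof (induction xs rule: rev_induct)
    case (snoc x xs)
    then have "(xs @ [x], xs) \<in> parcs (binary_tree n)" "xs \<in> pverts (binary_tree n)"
      by (auto simp: binary_tree_def)
    with snoc.IH show ?case by (meson converse_rtrancl_into_rtrancl)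
  qed simp
  from reachable_if_root[OF this assms] show ?thesis .
qed

lemma mspace_binary_tree: "mspace (graph_metric (binary_tree n)) = {xs. length xs \<le> n}"
  and mdist_binary_tree:
    "mdist (graph_metric (binary_tree n)) u v = real (graph_dist (binary_tree n) u v)"
proof -
  interpret pair_graph "binary_tree n" by (rule pair_graph_binary_tree)
  show "mspace (graph_metric (binary_tree n)) = {xs. length xs \<le> n}"
    using mspace_graph_metric[OF binary_tree_connected] by (simp add: binary_tree_def)
  show "mdist (graph_metric (binary_tree n)) u v = real (graph_dist (binary_tree n) u v)"
    by (rule mdist_graph_metric[OF binary_tree_connected])
qed


section \<open>Diamond graphs\<close>

text \<open>
  \<open>Mid u v False\<close> and \<open>Mid u v True\<close> are the two vertices \<open>a\<close>, \<open>b\<close> of the quadrilateral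
  \<open>u, a, v, b\<close> that replaces the edge \<open>uv\<close>.
\<close>

datatype diamond_vertex = Bottom | Top | Mid diamond_vertex diamond_vertex bool

text \<open>
  Every edge is listed exactly once, with a fixed orientation, so that exactly two new vertices
  are added per edge; see \<open>diamond_edges_antisym\<close> and \<open>Mid_fresh\<close>.
\<close>

primrec diamond_edges :: "nat \<Rightarrow> (diamond_vertex \<times> diamond_vertex) set" where
  "diamond_edges 0 = {(Bottom, Top)}"
| "diamond_edges (Suc m) =
    (\<Union>(u, v) \<in> diamond_edges m. \<Union>i. {(u, Mid u v i), (Mid u v i, v)})"

primrec diamond_verts :: "nat \<Rightarrow> diamond_vertex set" where
  "diamond_verts 0 = {Bottom, Top}"
| "diamond_verts (Suc m) =
    diamond_verts m \<union> {Mid u v i | u v i. (u, v) \<in> diamond_edges m}"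

definition diamond :: "nat \<Rightarrow> diamond_vertex pair_pre_digraph" where
  "diamond m = \<lparr> pverts = diamond_verts m, parcs = diamond_edges m \<union> (diamond_edges m)\<inverse> \<rparr>"

lemma diamond_edges_verts:
  "(u, v) \<in> diamond_edges m \<Longrightarrow> u \<in> diamond_verts m \<and> v \<in> diamond_verts m"
proof (induction m arbitrary: u v)
  case (Suc m)
  then obtain x y i where xy: "(x, y) \<in> diamond_edges m"
    "(u = x \<and> v = Mid x y i) \<or> (u = Mid x y i \<and> v = y)"
    by auto
  then have "Mid x y i \<in> diamond_verts (Suc m)" by auto
  with Suc.IH[OF xy(1)] xy(2) show ?case by auto
qed simp

fun mid_depth :: "diamond_vertex \<Rightarrow> nat" where
  "mid_depth Bottom = 0"
| "mid_depth Top = 0"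
| "mid_depth (Mid u v i) = Suc (max (mid_depth u) (mid_depth v))"

lemma mid_depth_edge:
  "(u, v) \<in> diamond_edges m \<Longrightarrow> max (mid_depth u) (mid_depth v) = m"
proof (induction m arbitrary: u v)
  case (Suc m)
  then obtain x y i where xy: "(x, y) \<in> diamond_edges m"
    "(u = x \<and> v = Mid x y i) \<or> (u = Mid x y i \<and> v = y)"
    by auto
  from Suc.IH[OF xy(1)] xy(2) show ?case by auto
qed simp

lemma mid_depth_vert: "v \<in> diamond_verts m \<Longrightarrow> mid_depth v \<le> m"
  by (induction m) (auto dest: mid_depth_edge simp: le_SucI)

lemma Mid_fresh: "(u, v) \<in> diamond_edges m \<Longrightarrow> Mid u v i \<notin> diamond_verts m"
  by (auto dest!: mid_depth_edge mid_depth_vert)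

lemma diamond_edges_irrefl: "(u, u) \<notin> diamond_edges m"
proof (induction m arbitrary: u)
  case (Suc m)
  show ?case
  proof
    assume "(u, u) \<in> diamond_edges (Suc m)"
    then obtain x y i where "(x, y) \<in> diamond_edges m" "Mid x y i = x \<or> Mid x y i = y"
      by auto
    then show False using Mid_fresh diamond_edges_verts by metis
  qed
qed simp

lemma diamond_edges_antisym:
  "(u, v) \<in> diamond_edges m \<Longrightarrow> (v, u) \<notin> diamond_edges m"
proof (induction m arbitrary: u v)
  case (Suc m)
  show ?case
  proof
    assume vu: "(v, u) \<in> diamond_edges (Suc m)"
    from Suc.prems obtain x y i where 1: "(x, y) \<in> diamond_edges m"
      "(u = x \<and> v = Mid x y i) \<or> (u = Mid x y i \<and> v = y)" by auto
    from vu obtain x' y' i' where 2: "(x', y') \<in> diamond_edges m"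
      "(v = x' \<and> u = Mid x' y' i') \<or> (v = Mid x' y' i' \<and> u = y')" by auto
    have "Mid x y i \<notin> diamond_verts m" "Mid x' y' i' \<notin> diamond_verts m"
      using Mid_fresh[OF 1(1)] Mid_fresh[OF 2(1)] by blast+
    with 1 2 diamond_edges_verts[OF 1(1)] diamond_edges_verts[OF 2(1)]
    show False using diamond_edges_irrefl diamond_vertex.inject by metis
  qed
qed simp

lemma finite_diamond_edges: "finite (diamond_edges m)"
  by (induction m) auto

lemma finite_diamond_verts: "finite (diamond_verts m)"
proof (induction m)
  case (Suc m)
  have "{Mid u v i | u v i. (u, v) \<in> diamond_edges m} =
      (\<lambda>((u, v), i). Mid u v i) ` (diamond_edges m \<times> UNIV)"
    by force
  with Suc finite_diamond_edges[of m] show ?case by simp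
qed simp

lemma pair_graph_diamond: "pair_graph (diamond m)"
proof
  show "fst e \<in> pverts (diamond m)" "snd e \<in> pverts (diamond m)" if "e \<in> parcs (diamond m)" for e
    using that diamond_edges_verts[of _ _ m] by (cases e; auto simp: diamond_def)+
  show "fst e \<noteq> snd e" if "e \<in> parcs (diamond m)" for e
    using that diamond_edges_irrefl[of _ m] by (cases e; auto simp: diamond_def)
qed (auto simp: diamond_def symmetric_def sym_def finite_diamond_verts finite_diamond_edges)

lemma diamond_connected:
  assumes "u \<in> pverts (diamond m)" "v \<in> pverts (diamond m)"
  shows "u \<rightarrow>\<^sup>*\<^bsub>diamond m\<^esub> v"
proof -
  have "(w, Bottom) \<in> (diamond_edges m \<union> (diamond_edges m)\<inverse>)\<^sup>*"
    if "w \<in> diamond_verts m" for w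
    using that
  proof (induction m arbitrary: w)
    case 0
    then show ?case by auto
  next
    case (Suc m)
    let ?E = "diamond_edges m \<union> (diamond_edges m)\<inverse>"
    let ?E' = "diamond_edges (Suc m) \<union> (diamond_edges (Suc m))\<inverse>"
    have new: "(x, Mid x y i) \<in> diamond_edges (Suc m)" "(Mid x y i, y) \<in> diamond_edges (Suc m)"
      if "(x, y) \<in> diamond_edges m" for x y i
      using that by auto
    have step: "(x, y) \<in> ?E'\<^sup>*" if "(x, y) \<in> ?E" for x y
    proof -
      have "(x, y) \<in> ?E' O ?E'"
      proof (cases "(x, y) \<in> diamond_edges m")
        case True
        then have "(x, Mid x y True) \<in> ?E'" "(Mid x y True, y) \<in> ?E'"
          using new[OF True] by blast+
        then show ?thesis by blast
      next
        case False
        with that have "(y, x) \<in> diamond_edges m" by auto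
        then have "(x, Mid y x True) \<in> ?E'" "(Mid y x True, y) \<in> ?E'"
          using new by blast+
        then show ?thesis by blast
      qed
      then obtain z where "(x, z) \<in> ?E'" "(z, y) \<in> ?E'" by blast
      then show ?thesis by (meson r_into_rtrancl rtrancl_trans)
    qed
    then have sub: "?E\<^sup>* \<subseteq> ?E'\<^sup>*" by (intro rtrancl_subset_rtrancl) auto
    show ?case
    proof (cases "w \<in> diamond_verts m")
      case True
      with Suc.IH sub show ?thesis by blast
    next
      case False
      with Suc.prems obtain x y i where w: "w = Mid x y i" "(x, y) \<in> diamond_edges m"
        by auto
      then have "(w, x) \<in> ?E'" using new by blast
      moreover have "(x, Bottom) \<in> ?E'\<^sup>*"
        using Suc.IH sub diamond_edges_verts[OF w(2)] by blast
      ultimately show ?thesis by (rule converse_rtrancl_into_rtrancl)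
    qed
  qed
  then have root: "(w, Bottom) \<in> (parcs (diamond m))\<^sup>*" if "w \<in> pverts (diamond m)" for w
    using that by (simp add: diamond_def)
  interpret pair_graph "diamond m" by (rule pair_graph_diamond)
  from reachable_if_root[OF root assms] show ?thesis .
qed

lemma mspace_diamond: "mspace (graph_metric (diamond m)) = diamond_verts m"
  and mdist_diamond:
    "mdist (graph_metric (diamond m)) u v = real (graph_dist (diamond m) u v)"
proof -
  interpret pair_graph "diamond m" by (rule pair_graph_diamond)
  show "mspace (graph_metric (diamond m)) = diamond_verts m"
    using mspace_graph_metric[OF diamond_connected] by (simp add: diamond_def)
  show "mdist (graph_metric (diamond m)) u v = real (graph_dist (diamond m) u v)"
    by (rule mdist_graph_metric[OF diamond_connected])
qed


section \<open>Distortion\<close>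

text \<open>
  The target sequence is indexed from 1. The infimum is taken in the extended reals, so that it
  is \<open>\<infinity>\<close> if no such embedding exists.
\<close>

definition distortion :: "(nat \<Rightarrow> 'b metric) \<Rightarrow> 'a metric \<Rightarrow> ereal" where
  "distortion R M =
    Inf {ereal C | C. 1 \<le> C \<and>
      (\<exists>m\<ge>1. \<exists>f. f ` mspace M \<subseteq> mspace (R m) \<and> (\<exists>r>0.
        \<forall>u\<in>mspace M. \<forall>v\<in>mspace M.
          r * mdist M u v \<le> mdist (R m) (f u) (f v) \<and>
          mdist (R m) (f u) (f v) \<le> r * C * mdist M u v))}"

end

theory Submission
  imports Defs
begin

text \<open>
  Upper bound: the neighbours of \<open>Bottom\<close> in \<open>D\<^bsub>n+1\<^esub>\<close> are \<open>2\<^bsup>n+1\<^esup>\<close> points at mutual distance 2,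
  so an injection of \<open>T\<^sub>n\<close> into them has distortion at most the diameter \<open>2n\<close> of \<open>T\<^sub>n\<close>.

  Lower bound: removing the vertices of \<open>D\<^sub>j\<close> from \<open>D\<^sub>m\<close> leaves pieces, one inside each edge of
  \<open>D\<^sub>j\<close>, of size about \<open>2\<^bsup>m-j\<^esup>\<close>, and each such piece contains only two vertices of \<open>D\<^bsub>j+1\<^esub>\<close>. If the
  image of a subtree stays farther than one (stretched) tree edge from \<open>D\<^sub>j\<close>, then it lies in one
  piece. The part of the tree mapped close to a given vertex has diameter at most \<open>2C\<close>; so descending
  \<open>O(C)\<close> levels one finds a subtree that also avoids the two new vertices, and hence lies in a piece of
  half the size. Starting at the scale of the diameter of the image, after about \<open>log n\<close> such steps
  the piece is too small for the remaining subtree, whose depth is at least \<open>n - O(C log n)\<close>. So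
  \<open>C log n\<close> is at least a constant times \<open>n\<close>.
\<close>

section \<open>Lipschitz functions and geodesics\<close>

context pair_sym_digraph
begin

lemma graph_dist_pred:
  assumes "u \<rightarrow>\<^sup>*\<^bsub>G\<^esub> v" "u \<noteq> v"
  obtains w where "(w, v) \<in> parcs G" "u \<rightarrow>\<^sup>*\<^bsub>G\<^esub> w" "Suc (graph_dist G u w) \<le> graph_dist G u v"
proof -
  obtain p where p: "apath u p v" "length p = graph_dist G u v"
    using graph_dist_apath[OF assms(1)] .
  have aw: "awalk u p v" using p(1) by (rule awalkI_apath)
  have "p \<noteq> []" using aw assms(2) by (auto simp: awalk_Nil_iff)
  then obtain q e where q: "p = q @ [e]" by (cases p rule: rev_cases) auto
  from aw q obtain w where w: "awalk u q w" "awalk w [e] v" by auto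
  then have "e = (w, v)" "e \<in> parcs G"
    by (cases e; auto simp: awalk_Cons_iff awalk_Nil_iff)+
  moreover have "u \<rightarrow>\<^sup>*\<^bsub>G\<^esub> w" using w(1) by (rule reachable_awalkI)
  moreover have "Suc (graph_dist G u w) \<le> graph_dist G u v"
    using graph_dist_le[OF w(1)] p(2) q by simp
  ultimately show ?thesis using that by blast
qed

lemma graph_dist_arc: "(u, v) \<in> parcs G \<Longrightarrow> graph_dist G u v \<le> 1"
  using graph_dist_le[of u "[(u, v)]" v]
  by (auto simp: awalk_Cons_iff awalk_Nil_iff dest: in_arcsD1 in_arcsD2)

text \<open>Distance estimates below come from this instead of from paths: it suffices to find a
  function that changes by at most \<open>c\<close> along every arc.\<close>

lemma graph_dist_lipschitz:
  fixes \<phi> :: "'a \<Rightarrow> real"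
  assumes lip: "\<And>a b. (a, b) \<in> parcs G \<Longrightarrow> \<phi> b \<le> \<phi> a + c" and "0 \<le> c" and "u \<rightarrow>\<^sup>*\<^bsub>G\<^esub> v"
  shows "\<phi> v \<le> \<phi> u + c * real (graph_dist G u v)"
  using assms(3)
proof (induction "graph_dist G u v" arbitrary: v rule: less_induct)
  case less
  show ?case
  proof (cases "u = v")
    case True
    then show ?thesis using \<open>0 \<le> c\<close> by simp
  next
    case False
    obtain w where w: "(w, v) \<in> parcs G" "u \<rightarrow>\<^sup>*\<^bsub>G\<^esub> w" "Suc (graph_dist G u w) \<le> graph_dist G u v"
      using graph_dist_pred[OF less.prems False] .
    have "\<phi> v \<le> \<phi> w + c" using lip w(1) .
    also have "\<dots> \<le> \<phi> u + c * real (graph_dist G u w) + c" using less.hyps[of w] w by simp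
    also have "\<dots> = \<phi> u + c * real (Suc (graph_dist G u w))" by (simp add: algebra_simps)
    also have "\<dots> \<le> \<phi> u + c * real (graph_dist G u v)"
      using w(3) \<open>0 \<le> c\<close> by (intro add_left_mono mult_left_mono) auto
    finally show ?thesis .
  qed
qed

text \<open>Vertices on a shortest path from \<open>u\<close> to \<open>v\<close> are no farther
  from \<open>u\<close> than \<open>v\<close> is, so the path misses \<open>S\<close> and
  \<open>h\<close> never changes along it.\<close>

lemma invariant_off_separator:
  assumes inv: "\<And>a b. (a, b) \<in> parcs G \<Longrightarrow> a \<notin> S \<Longrightarrow> b \<notin> S \<Longrightarrow> h a = h b"
    and "u \<rightarrow>\<^sup>*\<^bsub>G\<^esub> v" and far: "\<And>p. p \<in> S \<Longrightarrow> graph_dist G u v < graph_dist G u p"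
  shows "h u = h v"
  using assms(2,3)
proof (induction "graph_dist G u v" arbitrary: v rule: less_induct)
  case less
  show ?case
  proof (cases "u = v")
    case False
    obtain w where w: "(w, v) \<in> parcs G" "u \<rightarrow>\<^sup>*\<^bsub>G\<^esub> w" "Suc (graph_dist G u w) \<le> graph_dist G u v"
      using graph_dist_pred[OF less.prems(1) False] .
    have "h u = h w"
      using less.prems(2) w by (intro less.hyps) fastforce+
    moreover have "h w = h v"
      using less.prems(2)[of w] less.prems(2)[of v] w by (intro inv) auto
    ultimately show ?thesis by simp
  qed simp
qed

end


section \<open>Distances in binary trees\<close>

abbreviation tdist :: "nat \<Rightarrow> bool list \<Rightarrow> bool list \<Rightarrow> real" where
  "tdist n u v \<equiv> real (graph_dist (binary_tree n) u v)"

lemma Metric_space_tdist: "Metric_space {xs. length xs \<le> n} (tdist n)"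
proof -
  interpret pair_graph "binary_tree n" by (rule pair_graph_binary_tree)
  show ?thesis
    using Metric_space_graph_dist[OF binary_tree_connected] by (simp add: binary_tree_def)
qed

lemma binary_tree_reachable:
  "length u \<le> n \<Longrightarrow> length v \<le> n \<Longrightarrow> u \<rightarrow>\<^sup>*\<^bsub>binary_tree n\<^esub> v"
  by (rule binary_tree_connected) (simp_all add: binary_tree_def)

lemma tdist_snoc: "length u < n \<Longrightarrow> tdist n u (u @ [b]) \<le> 1"
proof -
  assume "length u < n"
  interpret pair_graph "binary_tree n" by (rule pair_graph_binary_tree)
  have "(u, u @ [b]) \<in> parcs (binary_tree n)"
    using \<open>length u < n\<close> by (auto simp: binary_tree_def)
  from graph_dist_arc[OF this] show ?thesis by simp
qed

lemma tdist_Nil: "length u \<le> n \<Longrightarrow> tdist n [] u \<le> length u"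
proof (induction u rule: rev_induct)
  case Nil
  interpret Metric_space "{xs. length xs \<le> n}" "tdist n" by (rule Metric_space_tdist)
  show ?case by simp
next
  case (snoc b u)
  interpret Metric_space "{xs. length xs \<le> n}" "tdist n" by (rule Metric_space_tdist)
  have "tdist n [] (u @ [b]) \<le> tdist n [] u + tdist n u (u @ [b])"
    using snoc.prems by (intro triangle) auto
  with snoc.IH snoc.prems tdist_snoc[of u n b] show ?case by simp
qed

lemma tdist_le:
  assumes "length u \<le> n" "length v \<le> n"
  shows "tdist n u v \<le> 2 * real n"
proof -
  interpret Metric_space "{xs. length xs \<le> n}" "tdist n" by (rule Metric_space_tdist)
  have "tdist n u v \<le> tdist n u [] + tdist n [] v" using assms by (intro triangle) auto
  with tdist_Nil[OF assms(1)] tdist_Nil[OF assms(2)] commute[of u "[]"] assms show ?thesis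
    by simp
qed

text \<open>Every path leaving the subtree below \<open>p\<close> passes the parent of
  \<open>p\<close>, whose depth is \<open>length p - 1\<close>.\<close>

lemma tdist_ge:
  assumes "length x \<le> n" "length y \<le> n" "p \<noteq> []"
    and "take (length p) x = p" "take (length p) y \<noteq> p"
  shows "real (length x) + real (length y) - 2 * (real (length p) - 1) \<le> tdist n x y"
proof -
  interpret pair_graph "binary_tree n" by (rule pair_graph_binary_tree)
  define \<phi> where "\<phi> z = (if take (length p) z = p then 1 else - 1) *
    (real (length z) - (real (length p) - 1))" for z
    \<comment> \<open>vanishes at the parent of \<open>p\<close>, where the sign changes\<close>
  have snoc: "\<bar>\<phi> (z @ [b]) - \<phi> z\<bar> \<le> 1" for z b
  proof -
    consider "length p \<le> length z" | "length z + 1 = length p" | "length z + 1 < length p"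
      by linarith
    then show ?thesis
    proof cases
      case 1
      then show ?thesis by (simp add: \<phi>_def)
    next
      case 2
      then have "\<phi> z = 0" unfolding \<phi>_def by (simp flip: 2)
      moreover have "real (length (z @ [b])) - (real (length p) - 1) = 1" by (simp flip: 2)
      ultimately show ?thesis unfolding \<phi>_def by auto
    next
      case 3
      then have "take (length p) z \<noteq> p" "take (length p) (z @ [b]) \<noteq> p" by auto
      then show ?thesis by (simp add: \<phi>_def)
    qed
  qed
  have "\<phi> b \<le> \<phi> a + 1" if "(a, b) \<in> parcs (binary_tree n)" for a b
    using that snoc[of a] snoc[of b] by (auto simp: binary_tree_def abs_le_iff algebra_simps)
  then have "\<phi> x \<le> \<phi> y + 1 * tdist n y x"
    using assms by (intro graph_dist_lipschitz binary_tree_reachable) auto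
  with assms show ?thesis by (simp add: \<phi>_def graph_dist_sym[of x])
qed


section \<open>Distances and cells in diamond graphs\<close>

abbreviation ddist :: "nat \<Rightarrow> diamond_vertex \<Rightarrow> diamond_vertex \<Rightarrow> real" where
  "ddist m u v \<equiv> real (graph_dist (diamond m) u v)"

lemma Metric_space_ddist: "Metric_space (diamond_verts m) (ddist m)"
proof -
  interpret pair_graph "diamond m" by (rule pair_graph_diamond)
  show ?thesis
    using Metric_space_graph_dist[OF diamond_connected] by (simp add: diamond_def)
qed

lemma diamond_reachable:
  "u \<in> diamond_verts m \<Longrightarrow> v \<in> diamond_verts m \<Longrightarrow> u \<rightarrow>\<^sup>*\<^bsub>diamond m\<^esub> v"
  by (rule diamond_connected) (simp_all add: diamond_def)

lemma ddist_edge: "(u, v) \<in> diamond_edges m \<Longrightarrow> ddist m u v \<le> 1"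
proof -
  assume e: "(u, v) \<in> diamond_edges m"
  interpret pair_graph "diamond m" by (rule pair_graph_diamond)
  have "(u, v) \<in> parcs (diamond m)" using e by (simp add: diamond_def)
  from graph_dist_arc[OF this] show ?thesis by simp
qed

lemma ddist_lipschitz:
  fixes \<phi> :: "diamond_vertex \<Rightarrow> real"
  assumes "\<And>a b. (a, b) \<in> diamond_edges m \<Longrightarrow> \<bar>\<phi> b - \<phi> a\<bar> \<le> c"
    and "u \<in> diamond_verts m" "v \<in> diamond_verts m"
  shows "\<phi> v \<le> \<phi> u + c * ddist m u v"
proof -
  interpret pair_graph "diamond m" by (rule pair_graph_diamond)
  have "diamond_edges m \<noteq> {}" by (induction m) auto
  then have "0 \<le> c" using assms(1) by fastforce
  then show ?thesis
    using assms
    by (intro graph_dist_lipschitz diamond_reachable)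
      (auto simp: diamond_def abs_le_iff algebra_simps)
qed

section \<open>Nested diamond graphs and the scaling of their distances\<close>

lemma diamond_verts_mono: "j \<le> m \<Longrightarrow> diamond_verts j \<subseteq> diamond_verts m"
  by (induction rule: dec_induct) auto

text \<open>Lets \<open>cell\<close>, which recurses on vertex terms, decide membership in
  \<open>D_j\<close> by comparing depths.\<close>

lemma diamond_verts_iff_mid_depth:
  "v \<in> diamond_verts m \<Longrightarrow> v \<in> diamond_verts j \<longleftrightarrow> mid_depth v \<le> j"
proof (induction m)
  case 0
  then show ?case using diamond_verts_mono[of 0 j] by auto
next
  case (Suc m)
  show ?case
  proof (cases "v \<in> diamond_verts m")
    case False
    with Suc.prems obtain a b i where v: "v = Mid a b i" "(a, b) \<in> diamond_edges m" by auto
    then have "mid_depth v = Suc m" using mid_depth_edge by simp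
    with Suc.prems diamond_verts_mono[of "Suc m" j] mid_depth_vert[of v j] show ?thesis
      by (metis subsetD)
  qed (use Suc.IH in simp)
qed

lemma ddist_Suc:
  assumes u: "u \<in> diamond_verts m" and v: "v \<in> diamond_verts m"
  shows "ddist (Suc m) u v = 2 * ddist m u v"
proof (rule antisym)
  interpret S: Metric_space "diamond_verts (Suc m)" "ddist (Suc m)" by (rule Metric_space_ddist)
  \<comment> \<open>An old edge becomes a path of two new edges, so the refined distance from
    \<open>u\<close> is 2-Lipschitz on the old graph.\<close>
  have "\<bar>ddist (Suc m) u b - ddist (Suc m) u a\<bar> \<le> 2" if ab: "(a, b) \<in> diamond_edges m" for a b
  proof -
    let ?c = "Mid a b True"
    have e: "(a, ?c) \<in> diamond_edges (Suc m)" "(?c, b) \<in> diamond_edges (Suc m)"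
      using ab by auto
    have vs: "a \<in> diamond_verts (Suc m)" "b \<in> diamond_verts (Suc m)" "?c \<in> diamond_verts (Suc m)"
      "u \<in> diamond_verts (Suc m)"
      using diamond_edges_verts[OF e(1)] diamond_edges_verts[OF e(2)] u by auto
    have "ddist (Suc m) a b \<le> 2"
      using S.triangle[of a ?c b] vs ddist_edge[OF e(1)] ddist_edge[OF e(2)] by linarith
    then show ?thesis
      using S.triangle[of u a b] S.triangle[of u b a] S.commute[of a b] vs by linarith
  qed
  from ddist_lipschitz[of m "ddist (Suc m) u" 2 u v, OF this u v] u
  show "ddist (Suc m) u v \<le> 2 * ddist m u v" by simp
next
  interpret M: Metric_space "diamond_verts m" "ddist m" by (rule Metric_space_ddist)
  \<comment> \<open>A midpoint gets the mean of the values at its two parents, so each half edge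
    sees half of a change of at most 2. The default 0 is never reached: \<open>Bottom\<close> and
    \<open>Top\<close> are in every \<open>diamond_verts m\<close>.\<close>
  define \<psi> where "\<psi> z = (if z \<in> diamond_verts m then 2 * ddist m u z
    else case z of Mid a b i \<Rightarrow> ddist m u a + ddist m u b | _ \<Rightarrow> 0)" for z
  have "\<bar>\<psi> y - \<psi> x\<bar> \<le> 1" if xy: "(x, y) \<in> diamond_edges (Suc m)" for x y
  proof -
    obtain a b i where ab: "(a, b) \<in> diamond_edges m"
      "x = a \<and> y = Mid a b i \<or> x = Mid a b i \<and> y = b"
      using xy by auto
    have vs: "a \<in> diamond_verts m" "b \<in> diamond_verts m"
      using diamond_edges_verts[OF ab(1)] by auto
    have "\<psi> a = 2 * ddist m u a" "\<psi> b = 2 * ddist m u b"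
      "\<psi> (Mid a b i) = ddist m u a + ddist m u b"
      using vs Mid_fresh[OF ab(1)] by (simp_all add: \<psi>_def)
    moreover have "\<bar>ddist m u a - ddist m u b\<bar> \<le> 1"
      using M.triangle[of u a b] M.triangle[of u b a] M.commute[of a b] vs u ddist_edge[OF ab(1)]
      by linarith
    ultimately show ?thesis using ab(2) by auto
  qed
  from ddist_lipschitz[of "Suc m" \<psi> 1 u v, OF this] u v
  show "2 * ddist m u v \<le> ddist (Suc m) u v" by (simp add: \<psi>_def)
qed

lemma ddist_scale:
  assumes "j \<le> m" "u \<in> diamond_verts j" "v \<in> diamond_verts j"
  shows "ddist m u v = 2 ^ (m - j) * ddist j u v"
  using assms(1)
proof (induction m rule: dec_induct)
  case (step k)
  then have "u \<in> diamond_verts k" "v \<in> diamond_verts k"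
    using diamond_verts_mono assms by blast+
  from ddist_Suc[OF this] step show ?case by (simp add: Suc_diff_le)
qed simp

lemma ddist_coarse_ge:
  assumes "j \<le> m" "u \<in> diamond_verts j" "v \<in> diamond_verts j" "u \<noteq> v"
  shows "2 ^ (m - j) \<le> ddist m u v"
proof -
  interpret Metric_space "diamond_verts j" "ddist j" by (rule Metric_space_ddist)
  have "ddist j u v \<noteq> 0" using assms zero[of u v] by simp
  then have "1 \<le> ddist j u v" by simp
  with ddist_scale[OF assms(1-3)] show ?thesis by simp
qed

text \<open>For a vertex of some \<open>D\<^sub>m\<close> that is not a vertex of \<open>D\<^sub>j\<close>, this is the edge of \<open>D\<^sub>j\<close> inside
  which the vertex was created; for all other vertices the value is meaningless.\<close>

fun cell :: "nat \<Rightarrow> diamond_vertex \<Rightarrow> diamond_vertex \<times> diamond_vertex" where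
  "cell j (Mid u v i) =
    (if mid_depth u > j then cell j u else if mid_depth v > j then cell j v else (u, v))"
| "cell j Bottom = (Bottom, Top)"
| "cell j Top = (Bottom, Top)"

text \<open>An edge joins a midpoint to one of its parents. If both parents are finer than
  \<open>D_j\<close>, \<open>cell\<close> follows the first; the induction hypothesis for the edge
  between them shows that the second lies in the same cell.\<close>

lemma cell_edge:
  "(x, y) \<in> diamond_edges m \<Longrightarrow> mid_depth x > j \<Longrightarrow> mid_depth y > j \<Longrightarrow> cell j x = cell j y"
proof (induction m arbitrary: x y)
  case (Suc m)
  then obtain a b i where ab: "(a, b) \<in> diamond_edges m"
    "x = a \<and> y = Mid a b i \<or> x = Mid a b i \<and> y = b"
    by auto
  then show ?case using Suc.IH[OF ab(1)] Suc.prems by auto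
qed simp

lemma cell_eq_if_far:
  assumes "x \<in> diamond_verts m" "y \<in> diamond_verts m"
    and "j \<le> m" and far: "\<And>p. p \<in> diamond_verts j \<Longrightarrow> ddist m x y < ddist m x p"
  shows "cell j x = cell j y"
proof -
  interpret pair_graph "diamond m" by (rule pair_graph_diamond)
  have edge: "cell j a = cell j b"
    if "(a, b) \<in> diamond_edges m" "a \<notin> diamond_verts j" "b \<notin> diamond_verts j" for a b
  proof -
    have "mid_depth a > j" "mid_depth b > j"
      using that diamond_edges_verts[OF that(1)] diamond_verts_iff_mid_depth by (meson not_le)+
    with that(1) show ?thesis by (rule cell_edge)
  qed
  show ?thesis
  proof (rule invariant_off_separator[where S = "diamond_verts j"])
    show "cell j a = cell j b"
      if "(a, b) \<in> parcs (diamond m)" "a \<notin> diamond_verts j" "b \<notin> diamond_verts j" for a b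
      using that edge[of a b] edge[of b a] by (auto simp: diamond_def)
  qed (use assms diamond_reachable in auto)
qed

text \<open>The subtracted 1 makes the induction close: refinement doubles the old bound to
  \<open>2 ^ (Suc m - j) - 2\<close>, and moving from a new vertex to a parent costs 1.\<close>

lemma ddist_cell:
  assumes "x \<in> diamond_verts m" "x \<notin> diamond_verts j" "j \<le> m"
  shows "fst (cell j x) \<in> diamond_verts m \<and> ddist m x (fst (cell j x)) \<le> 2 ^ (m - j) - 1"
  using assms(3,1,2)
proof (induction m arbitrary: x rule: dec_induct)
  case base
  then show ?case by simp
next
  case (step m)
  interpret Metric_space "diamond_verts (Suc m)" "ddist (Suc m)" by (rule Metric_space_ddist)
  have old: "fst (cell j a) \<in> diamond_verts m \<and>
      ddist (Suc m) a (fst (cell j a)) \<le> 2 ^ (Suc m - j) - 2"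
    if "a \<in> diamond_verts m" "a \<notin> diamond_verts j" for a
    using step.IH[OF that] ddist_Suc[of a m "fst (cell j a)"] that step.hyps
    by (auto simp: Suc_diff_le)
  show ?case
  proof (cases "x \<in> diamond_verts m")
    case True
    then show ?thesis using old[OF True step.prems(2)] by auto
  next
    case False
    with step.prems obtain a b i where x: "x = Mid a b i" and ab: "(a, b) \<in> diamond_edges m"
      by auto
    have vs: "a \<in> diamond_verts m" "b \<in> diamond_verts m"
      using diamond_edges_verts[OF ab] by auto
    have "(a, x) \<in> diamond_edges (Suc m)" "(x, b) \<in> diamond_edges (Suc m)"
      using x ab by auto
    then have d: "ddist (Suc m) x a \<le> 1" "ddist (Suc m) x b \<le> 1"
      using ddist_edge commute by metis+
    have via: "fst (cell j x) \<in> diamond_verts (Suc m) \<and>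
        ddist (Suc m) x (fst (cell j x)) \<le> 2 ^ (Suc m - j) - 1"
      if "cell j x = cell j y" "y \<in> diamond_verts m" "mid_depth y > j" "ddist (Suc m) x y \<le> 1" for y
    proof -
      have "y \<notin> diamond_verts j" using that mid_depth_vert[of y j] by auto
      from old[OF that(2) this] show ?thesis
        using triangle[of x y "fst (cell j y)"] that step.prems(1) by auto
    qed
    consider "mid_depth a > j" | "mid_depth a \<le> j" "mid_depth b > j"
      | "mid_depth a \<le> j" "mid_depth b \<le> j"
      by linarith
    then show ?thesis
    proof cases
      case 3
      have "(2::real) ^ 1 \<le> 2 ^ (Suc m - j)"
        using step.hyps by (intro power_increasing) auto
      with 3 vs d show ?thesis by (auto simp: x)
    qed (use via[of a] via[of b] vs d x in auto)
  qed
qed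

lemma ddist_same_cell:
  assumes "x \<in> diamond_verts m" "x \<notin> diamond_verts j" "y \<in> diamond_verts m" "y \<notin> diamond_verts j"
    and "j \<le> m" "cell j x = cell j y"
  shows "ddist m x y \<le> 2 * 2 ^ (m - j)"
proof -
  interpret Metric_space "diamond_verts m" "ddist m" by (rule Metric_space_ddist)
  have "ddist m x y \<le> ddist m x (fst (cell j x)) + ddist m y (fst (cell j x))"
    using triangle[of x "fst (cell j x)" y] commute[of y "fst (cell j x)"]
      ddist_cell[OF assms(1,2,5)] assms by simp
  with ddist_cell[OF assms(1,2,5)] ddist_cell[OF assms(3,4,5)] assms(6) show ?thesis by simp
qed


section \<open>The lower bound\<close>

locale tree_embedding =
  fixes n m :: nat and f :: "bool list \<Rightarrow> diamond_vertex" and r C :: real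
  assumes n: "n \<ge> 1" and C: "1 \<le> C" and r: "r > 0"
    and verts: "length u \<le> n \<Longrightarrow> f u \<in> diamond_verts m"
    and lower: "length u \<le> n \<Longrightarrow> length v \<le> n \<Longrightarrow> r * tdist n u v \<le> ddist m (f u) (f v)"
    and upper: "length u \<le> n \<Longrightarrow> length v \<le> n \<Longrightarrow> ddist m (f u) (f v) \<le> r * C * tdist n u v"
begin

sublocale Metric_space "diamond_verts m" "ddist m" by (rule Metric_space_ddist)

text \<open>The vertices of \<open>D\<^sub>j\<close> that are within one tree edge of the image of the subtree of depth \<open>d\<close>
  with root \<open>w\<close>.\<close>

definition near :: "nat \<Rightarrow> bool list \<Rightarrow> nat \<Rightarrow> diamond_vertex set" where
  "near j w d = {p \<in> diamond_verts j. \<exists>z. length z \<le> d \<and> ddist m (f (w @ z)) p \<le> r * C}"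

text \<open>Large enough that points of two subtrees that branch within the first two of these
  levels are at tree distance more than \<open>2 * C\<close>.\<close>

definition drop_depth :: nat where
  "drop_depth = nat \<lfloor>C\<rfloor> + 2"

lemma drop_depth_gt: "C + 1 < real drop_depth"
  unfolding drop_depth_def using C by linarith

lemma drop_depth_le: "real drop_depth \<le> 3 * C"
  unfolding drop_depth_def using C by linarith

lemma finite_near: "finite (near j w d)"
  unfolding near_def using finite_diamond_verts by simp

text \<open>Distances in \<open>D_m\<close> are integers, and adjacent tree vertices have distinct
  images.\<close>

lemma edge_length_ge_1: "1 \<le> r * C"
proof -
  interpret T: Metric_space "{xs. length xs \<le> n}" "tdist n" by (rule Metric_space_tdist)
  have "tdist n [] [True] \<noteq> 0" using n T.zero[of "[]" "[True]"] by simp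
  then have "0 < r * tdist n [] [True]" using r by simp
  also have "\<dots> \<le> ddist m (f []) (f [True])" using n by (intro lower) auto
  finally have "1 \<le> ddist m (f []) (f [True])" by simp
  also have "\<dots> \<le> r * C * tdist n [] [True]" using n by (intro upper) auto
  also have "\<dots> \<le> r * C * 1"
    using tdist_snoc[of "[]" n True] n r C by (intro mult_left_mono) auto
  finally show ?thesis by simp
qed

text \<open>Four subtrees of depth \<open>d - drop_depth\<close> are so far apart that each vertex of \<open>D\<^sub>j\<close> is near
  the image of at most one of them; hence two vertices cannot spoil all four.\<close>

lemma descend:
  assumes w: "length w + d \<le> n" and d: "drop_depth \<le> d" and j: "j \<le> m"
    and card: "card (near j w d) \<le> 2"
  obtains w' where "length w' + (d - drop_depth) \<le> n" "near j w' (d - drop_depth) = {}"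
proof -
  \<comment> \<open>The two bits choose one of four grandchildren; the padding leads down to depth
    \<open>drop_depth\<close> below \<open>w\<close>.\<close>
  define g where "g = (\<lambda>(a, b). [a, b] @ replicate (drop_depth - 2) False)"
  have len: "length (g ab) = drop_depth" for ab
    by (simp add: g_def drop_depth_def split: prod.split)
  have "\<exists>ab. near j (w @ g ab) (d - drop_depth) = {}"
  proof (rule ccontr)
    assume "\<not> ?thesis"
    then have "\<forall>ab. \<exists>p. p \<in> near j (w @ g ab) (d - drop_depth)" by blast
    then obtain p where p: "p ab \<in> near j (w @ g ab) (d - drop_depth)" for ab
      by metis
    have pw: "p ab \<in> near j w d" for ab
    proof -
      from p[of ab] obtain z where "p ab \<in> diamond_verts j" "length z \<le> d - drop_depth"
        "ddist m (f (w @ g ab @ z)) (p ab) \<le> r * C"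
        by (auto simp: near_def)
      with d show ?thesis by (auto simp: near_def len intro!: exI[of _ "g ab @ z"])
    qed
    have "inj p"
    proof (rule injI, rule ccontr)
      fix ab ab' assume eq: "p ab = p ab'" and ne: "ab \<noteq> ab'"
      from p[of ab] obtain z where pj: "p ab \<in> diamond_verts j" and z: "length z \<le> d - drop_depth"
        "ddist m (f (w @ g ab @ z)) (p ab) \<le> r * C"
        by (auto simp: near_def)
      from p[of ab'] obtain z' where z': "length z' \<le> d - drop_depth"
        "ddist m (f (w @ g ab' @ z')) (p ab) \<le> r * C"
        by (auto simp: near_def eq)
      let ?x = "w @ g ab @ z" and ?y = "w @ g ab' @ z'"
      have lx: "length ?x \<le> n" "length ?y \<le> n" using z(1) z'(1) w d by (auto simp: len)
      \<comment> \<open>The parent of \<open>?q\<close> has depth \<open>length w + 1\<close>, and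
        both points have depth at least \<open>length w + drop_depth\<close>; this gives the bound
        \<open>2 * drop_depth - 2\<close>.\<close>
      let ?q = "w @ [fst ab, snd ab]"
      have "take (length ?q) ?x = ?q" "take (length ?q) ?y \<noteq> ?q"
        using ne by (auto simp: g_def prod_eq_iff split: prod.splits)
      from tdist_ge[OF lx _ this]
      have "2 * real drop_depth - 2 \<le> tdist n ?x ?y" by (simp add: len)
      then have "2 * C < tdist n ?x ?y" using drop_depth_gt by linarith
      then have "r * (2 * C) < r * tdist n ?x ?y" using r by simp
      also have "\<dots> \<le> ddist m (f ?x) (f ?y)" using lower lx .
      also have "\<dots> \<le> ddist m (f ?x) (p ab) + ddist m (f ?y) (p ab)"
        using triangle[of "f ?x" "p ab" "f ?y"] commute[of "f ?y"] verts lx pj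
          diamond_verts_mono[OF j] by auto
      also have "\<dots> \<le> r * (2 * C)" using z(2) z'(2) by simp
      finally show False by simp
    qed
    then have "card (UNIV :: (bool \<times> bool) set) \<le> card (near j w d)"
      using pw finite_near by (intro card_inj_on_le[of p]) auto
    with card show False by (simp add: card_UNIV_bool flip: UNIV_Times_UNIV)
  qed
  then obtain ab where "near j (w @ g ab) (d - drop_depth) = {}" ..
  with w d show ?thesis by (intro that[of "w @ g ab"]) (auto simp: len)
qed

section \<open>Subtrees whose image stays away from \<open>D_j\<close>\<close>

lemma not_near_finest:
  assumes "length w + d \<le> n"
  shows "near m w d \<noteq> {}"
proof -
  have "f w \<in> near m w d"
    using assms verts[of w] edge_length_ge_1 by (auto simp: near_def intro!: exI[of _ "[]"])
  then show ?thesis by blast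
qed

lemma not_in_coarse:
  assumes "near j w d = {}" "length w + d \<le> n" "j \<le> m" "length z \<le> d"
  shows "f (w @ z) \<notin> diamond_verts j"
proof
  assume "f (w @ z) \<in> diamond_verts j"
  moreover have "ddist m (f (w @ z)) (f (w @ z)) \<le> r * C"
    using verts[of "w @ z"] assms edge_length_ge_1 by simp
  ultimately have "f (w @ z) \<in> near j w d"
    using assms by (auto simp: near_def)
  with assms(1) show False by blast
qed

text \<open>The image of a tree edge spans at most \<open>r * C\<close>, while all of
  \<open>D_j\<close> is farther than that from its starting point; so the cell cannot change along
  the edge.\<close>

lemma cell_subtree:
  assumes "near j w d = {}" "length w + d \<le> n" "j \<le> m" "length z \<le> d"
  shows "cell j (f (w @ z)) = cell j (f w)"
  using assms(4)
proof (induction z rule: rev_induct)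
  case (snoc b z)
  have "ddist m (f (w @ z)) (f ((w @ z) @ [b])) \<le> r * C * tdist n (w @ z) ((w @ z) @ [b])"
    using snoc.prems assms(2) by (intro upper) auto
  also have "\<dots> \<le> r * C * 1"
    using snoc.prems assms(2) r C by (intro mult_left_mono tdist_snoc) auto
  finally have le: "ddist m (f (w @ z)) (f (w @ z @ [b])) \<le> r * C" by simp
  have "cell j (f (w @ z)) = cell j (f (w @ z @ [b]))"
  proof (rule cell_eq_if_far)
    fix p assume "p \<in> diamond_verts j"
    then have "\<not> ddist m (f (w @ z)) p \<le> r * C"
      using assms(1) snoc.prems by (fastforce simp: near_def dest: Suc_leD)
    with le show "ddist m (f (w @ z)) (f (w @ z @ [b])) < ddist m (f (w @ z)) p" by linarith
  qed (use snoc.prems assms(2,3) in \<open>auto intro!: verts\<close>)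
  with snoc show ?case by simp
qed simp

text \<open>A near vertex must be a midpoint created inside the one cell that contains the image of
  the subtree, and a cell has only two such midpoints.\<close>

lemma card_near_Suc:
  assumes "near j w d = {}" "length w + d \<le> n" "j < m"
  shows "card (near (Suc j) w d) \<le> 2"
proof -
  obtain a b where ab: "cell j (f w) = (a, b)" by fastforce
  have "near (Suc j) w d \<subseteq> {Mid a b False, Mid a b True}"
  proof
    fix p assume "p \<in> near (Suc j) w d"
    then obtain z where p: "p \<in> diamond_verts (Suc j)" and z: "length z \<le> d"
      and le: "ddist m (f (w @ z)) p \<le> r * C"
      by (auto simp: near_def)
    have "p \<notin> diamond_verts j" using assms(1) z le by (auto simp: near_def)
    with p obtain x y i where xy: "p = Mid x y i" "(x, y) \<in> diamond_edges j" by auto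
    have depths: "mid_depth x \<le> j" "mid_depth y \<le> j" using mid_depth_edge[OF xy(2)] by auto
    have "cell j (f (w @ z)) = cell j p"
    proof (rule cell_eq_if_far)
      show "p \<in> diamond_verts m" using p assms(3) diamond_verts_mono[of "Suc j" m] by auto
      show "ddist m (f (w @ z)) p < ddist m (f (w @ z)) q" if "q \<in> diamond_verts j" for q
        using that assms(1) z le by (force simp: near_def)
    qed (use z assms in \<open>auto intro!: verts\<close>)
    also have "cell j p = (x, y)" using depths by (simp add: xy(1))
    finally have "(x, y) = (a, b)" using cell_subtree[OF assms(1,2) _ z] assms(3) ab by simp
    then show "p \<in> {Mid a b False, Mid a b True}" using xy(1) by (cases i) auto
  qed
  from card_mono[OF _ this] show ?thesis by (simp add: card_insert_if)
qed

text \<open>The root and a deepest vertex of the subtree are mapped into one cell, whose diameter is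
  bounded by \<open>ddist_same_cell\<close>.\<close>

lemma depth_le:
  assumes "near j w d = {}" "length w + d \<le> n" "j \<le> m"
  shows "r * d \<le> 2 * 2 ^ (m - j)"
proof (cases "d = 0")
  case False
  let ?x = "w @ replicate d False" and ?q = "w @ [False]"
  have "take (length ?q) ?x = ?q" "take (length ?q) w \<noteq> ?q" using False by (cases d; simp)+
  from tdist_ge[OF _ _ _ this, of n] have "real d \<le> tdist n ?x w" using assms(2) by simp
  then have "r * d \<le> r * tdist n ?x w" using r by simp
  also have "\<dots> \<le> ddist m (f ?x) (f w)" using assms(2) by (intro lower) auto
  also have "\<dots> \<le> 2 * 2 ^ (m - j)"
    using assms(2,3) not_in_coarse[OF assms, of "[]"] not_in_coarse[OF assms]
      cell_subtree[OF assms]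
    by (intro ddist_same_cell verts) auto
  finally show ?thesis .
qed simp

text \<open>At this scale \<open>D\<^sub>j\<close> is so sparse that the whole image is close to at most one of its
  vertices, unless \<open>j = 0\<close>, where there are only two vertices anyway.\<close>

lemma coarse_scale:
  obtains j where "j \<le> m" "card (near j [] n) \<le> 2" "2 ^ (m - j) \<le> 4 * (real n + 1) * (r * C)"
proof -
  \<comment> \<open>Bounds the distance between two vertices near the image:
    \<open>2 * n * r * C\<close> across the image and \<open>r * C\<close> at each end.\<close>
  define B where "B = 2 * (real n + 1) * (r * C)"
  have B1: "1 \<le> B"
  proof -
    have "1 * 1 \<le> (2 * (real n + 1)) * (r * C)" using edge_length_ge_1 by (intro mult_mono) auto
    then show ?thesis by (simp add: B_def)
  qed
  obtain K0 where "B < 2 ^ K0" using real_arch_pow[of 2 B] by auto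
  \<comment> \<open>Minimality gives \<open>2 ^ K\<close> at most \<open>2 * B\<close>;
    \<open>B1\<close> rules out \<open>K = 0\<close>.\<close>
  define K where "K = (LEAST k. B < 2 ^ k)"
  have K: "B < 2 ^ K" unfolding K_def using \<open>B < 2 ^ K0\<close> by (rule LeastI)
  then obtain k where k: "K = Suc k" using B1 by (cases K) auto
  have "\<not> B < 2 ^ k" using not_less_Least[of k "\<lambda>k. B < 2 ^ k"] k by (simp add: K_def)
  then have "2 ^ K \<le> 2 * B" by (simp add: k)
  then have K': "2 ^ K \<le> 4 * (real n + 1) * (r * C)" by (simp add: B_def algebra_simps)
  show thesis
  proof (cases "m \<le> K")
    case True
    have "near 0 [] n \<subseteq> {Bottom, Top}" by (auto simp: near_def)
    from card_mono[OF _ this] have "card (near 0 [] n) \<le> 2" by simp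
    moreover have "(2::real) ^ m \<le> 2 ^ K" using True by (intro power_increasing) auto
    then have "2 ^ m \<le> 4 * (real n + 1) * (r * C)" using K' by (rule order_trans)
    ultimately show ?thesis by (intro that[of 0]) simp_all
  next
    case False
    let ?j = "m - K"
    have sub: "p \<in> diamond_verts m" if "p \<in> diamond_verts ?j" for p
      using that diamond_verts_mono[of ?j m] by auto
    have "p = q" if "p \<in> near ?j [] n" "q \<in> near ?j [] n" for p q
    proof (rule ccontr)
      assume "p \<noteq> q"
      from that obtain x y where x: "length x \<le> n" "ddist m (f x) p \<le> r * C"
        and y: "length y \<le> n" "ddist m (f y) q \<le> r * C"
        and pq: "p \<in> diamond_verts ?j" "q \<in> diamond_verts ?j"
        by (auto simp: near_def)
      have "2 ^ (m - ?j) \<le> ddist m p q" using \<open>p \<noteq> q\<close> pq by (intro ddist_coarse_ge) auto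
      also have "\<dots> \<le> ddist m (f x) p + ddist m (f x) (f y) + ddist m (f y) q"
        using triangle[of p "f x" q] triangle[of "f x" "f y" q] commute[of p "f x"]
          verts x(1) y(1) sub[OF pq(1)] sub[OF pq(2)] by fastforce
      also have "\<dots> \<le> r * C + r * C * (2 * real n) + r * C"
      proof -
        have "ddist m (f x) (f y) \<le> r * C * tdist n x y" using x y by (intro upper)
        also have "\<dots> \<le> r * C * (2 * real n)"
          using x y r C by (intro mult_left_mono tdist_le) auto
        finally show ?thesis using x y by linarith
      qed
      also have "\<dots> = B" by (simp add: B_def algebra_simps)
      finally show False using K False by simp
    qed
    then have "card (near ?j [] n) \<le> 2"
      using card_le_Suc0_iff_eq[OF finite_near[of ?j "[]" n]] by fastforce
    then show ?thesis using K' False by (intro that[of ?j]) auto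
  qed
qed

text \<open>Each refinement of the scale halves the size of the cells and costs \<open>drop_depth\<close> levels of
  the tree.\<close>

lemma depth_tradeoff:
  assumes "drop_depth * Suc t \<le> n"
  shows "(real n - real drop_depth * real (Suc t)) * 2 ^ t \<le> 8 * (real n + 1) * C"
proof -
  obtain j where j: "j \<le> m" "card (near j [] n) \<le> 2"
    "2 ^ (m - j) \<le> 4 * (real n + 1) * (r * C)"
    using coarse_scale .
  \<comment> \<open>One descent clears the starting scale and each of the \<open>t\<close>
    refinements needs another, hence \<open>Suc t\<close>.\<close>
  have ex: "j + t \<le> m \<and> (\<exists>w. length w + (n - drop_depth * Suc t) \<le> n \<and>
      near (j + t) w (n - drop_depth * Suc t) = {})"
    using assms
  proof (induction t)
    case 0
    then show ?case using descend[of "[]" n j] j by auto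
  next
    case (Suc t)
    then obtain w where w: "length w + (n - drop_depth * Suc t) \<le> n"
      "near (j + t) w (n - drop_depth * Suc t) = {}" and le: "j + t \<le> m"
      by auto
    \<comment> \<open>At the finest scale the image itself is near, so an empty near set leaves room
      to refine.\<close>
    have "j + t \<noteq> m" using not_near_finest[OF w(1)] w(2) by auto
    with le have lt: "j + t < m" by simp
    have le': "drop_depth \<le> n - drop_depth * Suc t" using Suc.prems by simp
    obtain w' where "length w' + (n - drop_depth * Suc t - drop_depth) \<le> n"
      "near (Suc (j + t)) w' (n - drop_depth * Suc t - drop_depth) = {}"
      using descend[OF w(1) le' _ card_near_Suc[OF w(2,1) lt]] lt by auto
    moreover have "n - drop_depth * Suc t - drop_depth = n - drop_depth * Suc (Suc t)" by simp
    ultimately show ?case using lt by auto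
  qed
  then obtain w where w: "length w + (n - drop_depth * Suc t) \<le> n"
    "near (j + t) w (n - drop_depth * Suc t) = {}"
    by blast
  have "r * (real n - real drop_depth * real (Suc t)) = r * real (n - drop_depth * Suc t)"
    using assms by (simp add: of_nat_diff del: mult_Suc_right of_nat_Suc)
  also have "\<dots> \<le> 2 * 2 ^ (m - (j + t))" using depth_le[OF w(2,1)] ex by blast
  finally have "r * (real n - real drop_depth * real (Suc t)) * 2 ^ t
      \<le> 2 * 2 ^ (m - (j + t)) * 2 ^ t"
    by (rule mult_right_mono) simp
  also have "\<dots> = 2 * 2 ^ (m - j)"
    using ex by (simp flip: power_add)
  also have "\<dots> \<le> r * (8 * (real n + 1) * C)" using j(3) by (simp add: algebra_simps)
  finally show ?thesis using r by (simp add: mult.assoc)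
qed

lemma distortion_ge:
  assumes n2: "n \<ge> 2"
  shows "1 / 24 * (real n / log 2 (real n)) \<le> C"
proof (rule ccontr)
  assume less: "\<not> ?thesis"
  define l where "l = log 2 (real n)"
  have l1: "1 \<le> l" using n2 by (simp add: l_def)
  \<comment> \<open>The constant 24 is 2 * 3 * 4: \<open>drop_depth\<close> is at most
    \<open>3 * C\<close>, \<open>Suc t\<close> at most \<open>4 * l\<close>, and half of the depth
    \<open>n\<close> must survive.\<close>
  have Cl: "24 * (C * l) < n"
    using less l1 by (simp add: l_def[symmetric] field_simps)
  \<comment> \<open>Chosen so that \<open>2 ^ t\<close> is at least \<open>2 * n\<close>; the left
    side of the tradeoff is then at least \<open>n * n\<close>.\<close>
  define t where "t = nat \<lfloor>l\<rfloor> + 2"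
  have t: "real (Suc t) \<le> 4 * l" "l + 1 \<le> real t" using l1 unfolding t_def by linarith+
  have "real drop_depth * real (Suc t) \<le> (3 * C) * (4 * l)"
    using drop_depth_le t C by (intro mult_mono) auto
  with Cl have half: "real drop_depth * real (Suc t) \<le> n / 2" by simp
  then have "real (drop_depth * Suc t) \<le> real n" unfolding of_nat_mult by linarith
  then have "drop_depth * Suc t \<le> n" by (simp only: of_nat_le_iff)
  note tradeoff = depth_tradeoff[OF this]
  have "2 * real n = 2 powr (l + 1)" using n2 by (simp add: l_def powr_add)
  also have "\<dots> \<le> 2 powr (real t)" using t by simp
  also have "\<dots> = 2 ^ t" by (simp add: powr_realpow)
  finally have "(real n / 2) * (2 * real n) \<le>
      (real n - real drop_depth * real (Suc t)) * 2 ^ t"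
    using half by (intro mult_mono) auto
  also note tradeoff
  also have "8 * (real n + 1) * C \<le> 8 * (2 * real n) * (C * l)"
    using n2 C l1 by (intro mult_mono) auto
  also have "\<dots> < real n * real n" using Cl n2 C l1 by (simp add: field_simps)
  finally show False by simp
qed

end


section \<open>The upper bound\<close>

definition bottom_nbrs :: "nat \<Rightarrow> diamond_vertex set" where
  "bottom_nbrs m = {v. (Bottom, v) \<in> diamond_edges m}"

lemma card_bottom_nbrs: "card (bottom_nbrs m) = 2 ^ m"
proof (induction m)
  case 0
  then show ?case by (simp add: bottom_nbrs_def)
next
  case (Suc m)
  have "bottom_nbrs (Suc m) = (\<lambda>(v, i). Mid Bottom v i) ` (bottom_nbrs m \<times> UNIV)"
    by (auto simp: bottom_nbrs_def)
  also have "card \<dots> = card (bottom_nbrs m \<times> (UNIV :: bool set))"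
    by (intro card_image inj_onI) auto
  finally show ?case using Suc by (simp add: card_cartesian_product)
qed

text \<open>Every edge of \<open>diamond (Suc m)\<close> has an endpoint in
  \<open>diamond_verts m\<close>, whereas all neighbours of \<open>Bottom\<close> are new; so no two
  of them are adjacent.\<close>

lemma ddist_bottom_nbrs:
  assumes u: "u \<in> bottom_nbrs (Suc m)" and v: "v \<in> bottom_nbrs (Suc m)" and "u \<noteq> v"
  shows "ddist (Suc m) u v = 2"
proof -
  interpret Metric_space "diamond_verts (Suc m)" "ddist (Suc m)" by (rule Metric_space_ddist)
  interpret pair_graph "diamond (Suc m)" by (rule pair_graph_diamond)
  have e: "(Bottom, u) \<in> diamond_edges (Suc m)" "(Bottom, v) \<in> diamond_edges (Suc m)"
    using u v by (simp_all only: bottom_nbrs_def mem_Collect_eq)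
  note vs = diamond_edges_verts[OF e(1)] diamond_edges_verts[OF e(2)]
  have "ddist (Suc m) u v \<le> 2"
    using triangle[of u Bottom v] commute[of u Bottom] vs ddist_edge[OF e(1)] ddist_edge[OF e(2)]
    by linarith
  moreover have "graph_dist (diamond (Suc m)) u v \<noteq> 0" using \<open>u \<noteq> v\<close> vs zero[of u v] by simp
  moreover have "graph_dist (diamond (Suc m)) u v \<noteq> 1"
  proof
    assume d1: "graph_dist (diamond (Suc m)) u v = 1"
    obtain w where w: "(w, v) \<in> parcs (diamond (Suc m))"
      "Suc (graph_dist (diamond (Suc m)) u w) \<le> graph_dist (diamond (Suc m)) u v"
      using graph_dist_pred[OF diamond_reachable[of u "Suc m" v] \<open>u \<noteq> v\<close>] vs by blast
    have "w \<in> diamond_verts (Suc m)"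
      using w(1) diamond_edges_verts[of _ _ "Suc m"]
      by (auto simp del: diamond_edges.simps diamond_verts.simps simp: diamond_def)
    then have "w = u" using w(2) d1 vs zero[of u w] by simp
    with w(1) have "(u, v) \<in> diamond_edges (Suc m) \<or> (v, u) \<in> diamond_edges (Suc m)"
      by (simp del: diamond_edges.simps add: diamond_def)
    then obtain a b i where "(a, b) \<in> diamond_edges m" "u \<in> {a, b} \<or> v \<in> {a, b}" by auto
    then have "u \<in> diamond_verts m \<or> v \<in> diamond_verts m" using diamond_edges_verts by blast
    moreover have "mid_depth u = Suc m" "mid_depth v = Suc m"
      using mid_depth_edge[OF e(1)] mid_depth_edge[OF e(2)] by simp_all
    ultimately show False using mid_depth_vert by fastforce
  qed
  ultimately show ?thesis by linarith
qed

lemma distortion_le: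
  assumes "n \<ge> 1"
  shows "distortion (\<lambda>m. graph_metric (diamond m)) (graph_metric (binary_tree n))
    \<le> ereal (2 * real n)"
proof -
  interpret T: Metric_space "{xs. length xs \<le> n}" "tdist n" by (rule Metric_space_tdist)
  let ?T = "{xs :: bool list. length xs \<le> n}"
  have "card ?T = (\<Sum>i\<le>n. 2 ^ i)"
    using card_lists_length_le[of "UNIV :: bool set" n] by (simp add: card_UNIV_bool)
  also have "\<dots> \<le> (2 :: nat) ^ Suc n" by (induction n) auto
  finally have "card ?T \<le> card (bottom_nbrs (Suc n))" by (simp only: card_bottom_nbrs)
  moreover have "finite ?T" using finite_lists_length_le[of "UNIV :: bool set" n] by simp
  moreover have "finite (bottom_nbrs (Suc n))"
    by (rule card_ge_0_finite) (simp add: card_bottom_nbrs)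
  ultimately obtain f where f: "f ` ?T \<subseteq> bottom_nbrs (Suc n)" "inj_on f ?T"
    using card_le_inj by blast
  interpret D: Metric_space "diamond_verts (Suc n)" "ddist (Suc n)" by (rule Metric_space_ddist)
  have sub: "bottom_nbrs (Suc n) \<subseteq> diamond_verts (Suc n)"
    unfolding bottom_nbrs_def using diamond_edges_verts by blast
  \<comment> \<open>Distinct tree vertices have distance between 1 and \<open>2 * n\<close>, and all
    image distances are 2; the scale \<open>1 / n\<close> makes the lower bound at most 2.\<close>
  have "1 / real n * tdist n u v \<le> ddist (Suc n) (f u) (f v) \<and>
      ddist (Suc n) (f u) (f v) \<le> 1 / real n * (2 * real n) * tdist n u v"
    if uv: "u \<in> ?T" "v \<in> ?T" for u v
  proof (cases "u = v")
    case True
    with uv f(1) sub have "f v \<in> diamond_verts (Suc n)" by blast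
    with True uv show ?thesis using D.zero[of "f v" "f v"] T.zero[of v v] by simp
  next
    case False
    have "ddist (Suc n) (f u) (f v) = 2"
      using uv f False by (intro ddist_bottom_nbrs) (auto dest: inj_onD)
    moreover have "graph_dist (binary_tree n) u v \<noteq> 0" using uv False T.zero[of u v] by simp
    ultimately show ?thesis
      using tdist_le[of u n v] uv assms by (simp add: field_simps)
  qed
  then have "\<exists>r>0. \<forall>u\<in>?T. \<forall>v\<in>?T. r * tdist n u v \<le> ddist (Suc n) (f u) (f v) \<and>
      ddist (Suc n) (f u) (f v) \<le> r * (2 * real n) * tdist n u v"
    using assms by (intro exI[of _ "1 / real n"]) auto
  moreover have "f ` ?T \<subseteq> diamond_verts (Suc n)" using f(1) sub by blast
  ultimately have "\<exists>m\<ge>1. \<exists>f. f ` ?T \<subseteq> diamond_verts m \<and> (\<exists>r>0. \<forall>u\<in>?T. \<forall>v\<in>?T.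
      r * tdist n u v \<le> ddist m (f u) (f v) \<and>
      ddist m (f u) (f v) \<le> r * (2 * real n) * tdist n u v)"
    by (intro exI[of _ "Suc n"] exI[of _ f] conjI) simp_all
  moreover have "1 \<le> 2 * real n" using assms by simp
  ultimately show ?thesis
    unfolding distortion_def mspace_binary_tree mdist_binary_tree mspace_diamond mdist_diamond
    by (intro Inf_lower CollectI exI[of _ "2 * real n"] conjI refl)
qed

theorem theorem2p4:
  shows "\<exists>c::real. c > 0 \<and> (\<forall>n::nat. n \<ge> 2 \<longrightarrow>
    ereal (c * (real n / log 2 (real n)))
      \<le> distortion (\<lambda>m. graph_metric (diamond m)) (graph_metric (binary_tree n)) \<and>
    distortion (\<lambda>m. graph_metric (diamond m)) (graph_metric (binary_tree n))
      \<le> ereal (2 * real n))"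
proof (intro exI[of _ "1 / 24"] conjI allI impI)
  fix n :: nat assume n2: "2 \<le> n"
  show "ereal (1 / 24 * (real n / log 2 (real n)))
      \<le> distortion (\<lambda>m. graph_metric (diamond m)) (graph_metric (binary_tree n))"
    unfolding distortion_def mspace_binary_tree mdist_binary_tree mspace_diamond mdist_diamond
  proof (rule Inf_greatest, elim CollectE exE conjE)
    fix x C m f r
    assume x: "x = ereal C" and "1 \<le> C" "f ` {xs. length xs \<le> n} \<subseteq> diamond_verts m" "0 < r"
      and "\<forall>u\<in>{xs. length xs \<le> n}. \<forall>v\<in>{xs. length xs \<le> n}.
        r * tdist n u v \<le> ddist m (f u) (f v) \<and> ddist m (f u) (f v) \<le> r * C * tdist n u v"
    then interpret tree_embedding n m f r C using n2 by unfold_locales auto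
    show "ereal (1 / 24 * (real n / log 2 (real n))) \<le> x" using distortion_ge[OF n2] x by simp
  qed
  show "distortion (\<lambda>m. graph_metric (diamond m)) (graph_metric (binary_tree n))
      \<le> ereal (2 * real n)"
    using n2 by (intro distortion_le) simp
qed simp

end
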